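(* Let $n\ge 4$ and let $f(x)=x^n+a_2x^{n-2}+a_3x^{n-3}+\dots+a_{n-1}x+a_n$ be a monic polynomial (with zero coefficient of $x^{n-1}$) all of whose roots are real. Let $I=\{1,2,\dots,n-1\}$. Then $$\operatorname{spn}(f)\ge \left(8\left(\frac{a_2^2-2a_4}{n}+\frac{6a_2^2}{n^2}\right)\right)^{1/4},$$ $$\operatorname{spn}(f)\ge \left(\frac{2n^3(a_2^2-2a_4)}{\max_{j\in I} j(n-j)(n^2-3nj+3j^2)}\right)^{1/4}$$ and $$\operatorname{spn}(f)\ge \left(\frac{3^5}{n^2}\,a_2(2a_4-a_2^2)\right)^{1/6}.$$ Moreover, if $n$ is odd, then $$\operatorname{spn}(f)\ge \left(\frac{8n}{n^2-1}\left(a_2^2-2a_4+\frac{6}{n}a_2^2\right)\right)^{1/4}.$$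
   Context: "All roots real" means that $f$ has $n$ real roots counted with multiplicity. $\operatorname{spn}(f)$ denotes the span of $f$, i.e. the largest root of $f$ minus its smallest root. *)

theory Defs
  imports Complex_Main "HOL-Computational_Algebra.Polynomial"
begin

(* Intended for nonzero f only: the zero polynomial has infinitely many roots,
   and the sum is then 0 by convention. *)
definition all_roots_real :: "real poly \<Rightarrow> bool" where
  "all_roots_real f \<longleftrightarrow> (\<Sum>x | poly f x = 0. order x f) = degree f"

(* Meaningful only when f is nonzero and has at least one real root; it ranges over the real
   roots only, so it is the span of f when all_roots_real f holds. *)
definition spn :: "real poly \<Rightarrow> real" where
  "spn f = Max {x. poly f x = 0} - Min {x. poly f x = 0}"

end

theory Submission
  imports Defs
begin

text \<open>
  Let \<open>x\<^sub>1, \<dots>, x\<^sub>n\<close> be the roots and \<open>s\<close> the span. As \<open>p\<^sub>1 = 0\<close>, the power sums are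
  \<open>p\<^sub>2 = -2a\<^sub>2\<close> and \<open>p\<^sub>4 = 2a\<^sub>2\<^sup>2 - 4a\<^sub>4\<close>. All bounds come from maximising a convex function over
  the box \<open>[m, M]\<^sup>n\<close>, \<open>M - m = s\<close>, where only vertices (\<open>j\<close> coordinates equal to \<open>M\<close>, the
  others to \<open>m\<close>) matter. The functions are \<open>\<Sum>\<^sub>i\<^sub>,\<^sub>k (x\<^sub>i - x\<^sub>k)\<^sup>4 = 2np\<^sub>4 + 6p\<^sub>2\<^sup>2\<close> for the first and
  the last bound, the fourth central moment for the second, and for the third
  \<open>s\<^sup>2p\<^sub>2/3 + p\<^sub>4\<close>, combined with \<open>4uv \<le> (u + v)\<^sup>2\<close>. The weight 1/3 makes that AM-GM step an
  equality at the extremal value \<open>j(n - j)/n\<^sup>2 = 2/9\<close>.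
\<close>

section \<open>Convex functions on a box and their values at vertices\<close>

lemma convex_comb_square:
  fixes a b u :: real
  assumes "0 \<le> u" "u \<le> 1"
  shows "((1 - u) * a + u * b)\<^sup>2 \<le> (1 - u) * a\<^sup>2 + u * b\<^sup>2"
proof -
  have "(1 - u) * a\<^sup>2 + u * b\<^sup>2 - ((1 - u) * a + u * b)\<^sup>2 = u * (1 - u) * (a - b)\<^sup>2"
    by algebra
  moreover have "u * (1 - u) * (a - b)\<^sup>2 \<ge> 0"
    using assms by simp
  ultimately show ?thesis by linarith
qed

lemma convex_comb_power4:
  fixes a b u :: real
  assumes "0 \<le> u" "u \<le> 1"
  shows "((1 - u) * a + u * b) ^ 4 \<le> (1 - u) * a ^ 4 + u * b ^ 4"
proof -
  have pow4: "x ^ 4 = (x\<^sup>2)\<^sup>2" for x :: real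
    by simp
  have "((1 - u) * a + u * b) ^ 4 \<le> ((1 - u) * a\<^sup>2 + u * b\<^sup>2)\<^sup>2"
    unfolding pow4 using convex_comb_square[OF assms] by (intro power_mono) auto
  also have "\<dots> \<le> (1 - u) * a ^ 4 + u * b ^ 4"
    unfolding pow4 by (rule convex_comb_square[OF assms])
  finally show ?thesis .
qed

text \<open>Induction over the coordinates: with the others fixed, \<open>F\<close> is convex in one
  coordinate, so moving that coordinate to one of \<open>m\<close>, \<open>M\<close> does not
  decrease it. Coordinates outside \<open>I\<close> keep the value \<open>x i\<close>, which leaves
  the next coordinate still free in the induction step.\<close>

lemma convex_le_vertex_of_box:
  fixes F :: "('a \<Rightarrow> real) \<Rightarrow> real" and m M :: real
  assumes "finite I" and "x ` I \<subseteq> {m..M}"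
    and conv: "\<And>y z u. 0 \<le> u \<Longrightarrow> u \<le> 1 \<Longrightarrow>
      F (\<lambda>k. (1 - u) * y k + u * z k) \<le> (1 - u) * F y + u * F z"
  shows "\<exists>S\<subseteq>I. F x \<le> F (\<lambda>i. if i \<in> S then M else if i \<in> I then m else x i)"
  using assms(1,2)
proof (induction I)
  case empty
  show ?case by simp
next
  case (insert i I)
  then obtain S where S: "S \<subseteq> I"
    and le: "F x \<le> F (\<lambda>k. if k \<in> S then M else if k \<in> I then m else x k)" (is "_ \<le> F ?y")
    by auto
  have xi: "m \<le> x i" "x i \<le> M" using insert.prems by auto
  obtain u where u: "0 \<le> u" "u \<le> 1" "x i = (1 - u) * m + u * M"
  proof (cases "m = M")
    case True
    with xi that[of 0] show ?thesis by simp
  next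
    case False
    define u where "u = (x i - m) / (M - m)"
    have "u * (M - m) = x i - m" using False by (simp add: u_def)
    then have "x i = (1 - u) * m + u * M" by (simp add: algebra_simps)
    moreover have "0 \<le> u" "u \<le> 1" using False xi by (simp_all add: u_def)
    ultimately show ?thesis by (intro that)
  qed
  \<comment> \<open>As \<open>i\<close> is not in \<open>I\<close>, \<open>?y i\<close> is still
    \<open>x i\<close>, so \<open>?y\<close> lies on the segment between its two updates.\<close>
  have "?y = (\<lambda>k. (1 - u) * (?y(i := m)) k + u * (?y(i := M)) k)"
    using u(3) insert.hyps(2) S by (auto simp: fun_eq_iff algebra_simps)
  then have "F ?y \<le> (1 - u) * F (?y(i := m)) + u * F (?y(i := M))"
    using conv[OF u(1,2), of "?y(i := m)" "?y(i := M)"] by metis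
  also have "\<dots> \<le> max (F (?y(i := m))) (F (?y(i := M)))"
    using u(1,2) by (intro convex_bound_le) auto
  finally consider "F x \<le> F (?y(i := m))" | "F x \<le> F (?y(i := M))"
    using le by linarith
  then show ?case
  proof cases
    case 1
    have "?y(i := m) = (\<lambda>k. if k \<in> S then M else if k \<in> insert i I then m else x k)"
      using S insert.hyps(2) by (auto simp: fun_eq_iff)
    with 1 S show ?thesis by (intro exI[of _ S]) auto
  next
    case 2
    have "?y(i := M) = (\<lambda>k. if k \<in> insert i S then M else if k \<in> insert i I then m else x k)"
      using S insert.hyps(2) by (auto simp: fun_eq_iff)
    with 2 S show ?thesis by (intro exI[of _ "insert i S"]) auto
  qed
qed

lemma sum_two_valued:
  fixes g :: "real \<Rightarrow> real"
  assumes "finite I" "S \<subseteq> I"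
  shows "(\<Sum>i\<in>I. g (if i \<in> S then M else if i \<in> I then m else x i)) =
    real (card S) * g M + (real (card I) - real (card S)) * g m"
proof -
  have "(\<Sum>i\<in>I. g (if i \<in> S then M else if i \<in> I then m else x i)) =
     (\<Sum>i\<in>I - S. g m) + (\<Sum>i\<in>S. g M)"
    using assms by (subst sum.subset_diff[of S I]) (auto intro!: arg_cong2[of _ _ _ _ "(+)"] sum.cong)
  then show ?thesis
    using assms by (simp add: card_Diff_subset finite_subset card_mono of_nat_diff)
qed

text \<open>Each summand is the fourth power of a linear form, hence convex. At a vertex only pairs
  with one coordinate at \<open>M\<close> and the other at \<open>m\<close> contribute, and there
  are 2j(n - j) such ordered pairs.\<close>

lemma sum_pairs_power4_le:
  fixes x :: "'a \<Rightarrow> real"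
  assumes "finite I" and "x ` I \<subseteq> {m..M}"
  shows "\<exists>j\<le>card I. (\<Sum>i\<in>I. \<Sum>k\<in>I. (x i - x k) ^ 4) \<le>
    2 * real j * (real (card I) - real j) * (M - m) ^ 4"
proof -
  define F where "F = (\<lambda>x. \<Sum>i\<in>I. \<Sum>k\<in>I. (x i - x k :: real) ^ 4)"
  have conv: "F (\<lambda>k. (1 - u) * y k + u * z k) \<le> (1 - u) * F y + u * F z"
    if "0 \<le> u" "u \<le> 1" for y z u
  proof -
    have "((1 - u) * y i + u * z i - ((1 - u) * y k + u * z k)) ^ 4
      \<le> (1 - u) * (y i - y k) ^ 4 + u * (z i - z k) ^ 4" for i k
      using convex_comb_power4[OF that, of "y i - y k" "z i - z k"] by (simp add: algebra_simps)
    then show ?thesis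
      unfolding F_def sum_distrib_left sum.distrib[symmetric] by (intro sum_mono)
  qed
  have "\<exists>S\<subseteq>I. F x \<le> F (\<lambda>i. if i \<in> S then M else if i \<in> I then m else x i)"
    by (rule convex_le_vertex_of_box[OF assms(1,2), where F = F]) (fact conv)
  then obtain S where S: "S \<subseteq> I"
    and le: "F x \<le> F (\<lambda>i. if i \<in> S then M else if i \<in> I then m else x i)" (is "_ \<le> F ?y")
    by auto
  let ?j = "real (card S)" and ?n = "real (card I)"
  have inner: "(\<Sum>k\<in>I. (c - ?y k) ^ 4) = ?j * (c - M) ^ 4 + (?n - ?j) * (c - m) ^ 4" for c
    by (rule sum_two_valued[OF assms(1) S])
  have "F ?y = (\<Sum>i\<in>I. ?j * (?y i - M) ^ 4 + (?n - ?j) * (?y i - m) ^ 4)"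
    unfolding F_def inner ..
  also have "\<dots> = ?j * ((?n - ?j) * (M - m) ^ 4) + (?n - ?j) * (?j * (m - M) ^ 4)"
    by (subst sum_two_valued[OF assms(1) S]) simp
  also have "\<dots> = 2 * ?j * (?n - ?j) * (M - m) ^ 4"
    by (simp add: power4_eq_xxxx algebra_simps)
  finally show ?thesis
    using le card_mono[OF assms(1) S] by (auto simp: F_def)
qed

text \<open>A vertex need not have coordinate sum 0, so the convex function \<open>F\<close>
  subtracts the mean; it agrees with the moments about 0 at \<open>x\<close>. At a vertex the
  deviations are (n - j)(M - m)/n and -j(M - m)/n. The weights allow one lemma to serve both the
  single moments and their combination.\<close>

lemma central_moments_le:
  fixes x :: "'a \<Rightarrow> real" and \<alpha> \<beta> :: real
  assumes "finite I" "I \<noteq> {}" and "x ` I \<subseteq> {m..M}"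
    and "(\<Sum>i\<in>I. x i) = 0" and "\<alpha> \<ge> 0" "\<beta> \<ge> 0"
  defines "n \<equiv> real (card I)"
  shows "\<exists>j\<le>card I. \<alpha> * (\<Sum>i\<in>I. (x i)\<^sup>2) + \<beta> * (\<Sum>i\<in>I. (x i) ^ 4) \<le>
    \<alpha> * (real j * (n - real j) / n * (M - m)\<^sup>2) +
    \<beta> * (real j * (n - real j) * (n\<^sup>2 - 3 * n * real j + 3 * (real j)\<^sup>2) / n ^ 3 * (M - m) ^ 4)"
proof -
  have n: "n > 0" using assms(1,2) by (simp add: n_def card_gt_0_iff)
  define mean where "mean = (\<lambda>x. (\<Sum>i\<in>I. x i :: real) / n)"
  define F where "F = (\<lambda>x. \<Sum>i\<in>I. \<alpha> * (x i - mean x)\<^sup>2 + \<beta> * (x i - mean x) ^ 4)"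
  have conv: "F (\<lambda>k. (1 - u) * y k + u * z k) \<le> (1 - u) * F y + u * F z"
    if u: "0 \<le> u" "u \<le> 1" for y z u
  proof -
    let ?w = "\<lambda>k. (1 - u) * y k + u * z k"
    have "mean ?w = (1 - u) * mean y + u * mean z"
      by (simp add: mean_def sum.distrib sum_distrib_left add_divide_distrib)
    then have w: "?w i - mean ?w = (1 - u) * (y i - mean y) + u * (z i - mean z)" for i
      by (simp add: algebra_simps)
    have "\<alpha> * (?w i - mean ?w)\<^sup>2 + \<beta> * (?w i - mean ?w) ^ 4
      \<le> \<alpha> * ((1 - u) * (y i - mean y)\<^sup>2 + u * (z i - mean z)\<^sup>2)
        + \<beta> * ((1 - u) * (y i - mean y) ^ 4 + u * (z i - mean z) ^ 4)" for i
      unfolding w using convex_comb_square[OF u] convex_comb_power4[OF u] assms(5,6)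
      by (intro add_mono mult_left_mono)
    also have "\<dots> i = (1 - u) * (\<alpha> * (y i - mean y)\<^sup>2 + \<beta> * (y i - mean y) ^ 4)
        + u * (\<alpha> * (z i - mean z)\<^sup>2 + \<beta> * (z i - mean z) ^ 4)" for i
      by (simp add: algebra_simps)
    finally show ?thesis
      unfolding F_def sum_distrib_left sum.distrib[symmetric] by (intro sum_mono)
  qed
  have "\<exists>S\<subseteq>I. F x \<le> F (\<lambda>i. if i \<in> S then M else if i \<in> I then m else x i)"
    by (rule convex_le_vertex_of_box[OF assms(1,3), where F = F]) (fact conv)
  then obtain S where S: "S \<subseteq> I"
    and le: "F x \<le> F (\<lambda>i. if i \<in> S then M else if i \<in> I then m else x i)" (is "_ \<le> F ?y")
    by auto
  define j where "j = real (card S)"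
  have mean: "mean ?y = (j * M + (n - j) * m) / n"
    unfolding mean_def j_def n_def by (subst sum_two_valued[OF assms(1) S, of "\<lambda>x. x"]) simp
  have dM: "M - mean ?y = (n - j) * (M - m) / n" and dm: "m - mean ?y = - (j * (M - m) / n)"
    unfolding mean using n by (simp_all add: field_simps)
  have "j * (\<alpha> * ((n - j) * d / n)\<^sup>2 + \<beta> * ((n - j) * d / n) ^ 4)
     + (n - j) * (\<alpha> * (- (j * d / n))\<^sup>2 + \<beta> * (- (j * d / n)) ^ 4)
     = \<alpha> * (j * (n - j)\<^sup>2 + (n - j) * j\<^sup>2) * d\<^sup>2 / n\<^sup>2
     + \<beta> * (j * (n - j) ^ 4 + (n - j) * j ^ 4) * d ^ 4 / n ^ 4" for d
    using n by (simp add: power_divide power_mult_distrib divide_simps) algebra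
  note expand = this[of "M - m", folded dM dm]
  have "F ?y = j * (\<alpha> * (M - mean ?y)\<^sup>2 + \<beta> * (M - mean ?y) ^ 4)
     + (n - j) * (\<alpha> * (m - mean ?y)\<^sup>2 + \<beta> * (m - mean ?y) ^ 4)"
    unfolding F_def j_def n_def
    by (rule sum_two_valued[OF assms(1) S, of "\<lambda>t. \<alpha> * (t - mean ?y)\<^sup>2 + \<beta> * (t - mean ?y) ^ 4"])
  also have "\<dots> = \<alpha> * (j * (n - j)\<^sup>2 + (n - j) * j\<^sup>2) * (M - m)\<^sup>2 / n\<^sup>2
     + \<beta> * (j * (n - j) ^ 4 + (n - j) * j ^ 4) * (M - m) ^ 4 / n ^ 4"
    by (rule expand)
  \<comment> \<open>Both numerators contain j(n - j); the remaining factors are (n - j) + j = n and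
    (n - j)^3 + j^3, a sum of cubes divisible by n.\<close>
  also have "j * (n - j)\<^sup>2 + (n - j) * j\<^sup>2 = n * (j * (n - j))"
    by algebra
  also have "j * (n - j) ^ 4 + (n - j) * j ^ 4 = n * (j * (n - j) * (n\<^sup>2 - 3 * n * j + 3 * j\<^sup>2))"
    by algebra
  also have "\<alpha> * (n * (j * (n - j))) * (M - m)\<^sup>2 / n\<^sup>2 = \<alpha> * (j * (n - j) / n * (M - m)\<^sup>2)"
    using n by (simp add: power2_eq_square)
  also have "\<beta> * (n * (j * (n - j) * (n\<^sup>2 - 3 * n * j + 3 * j\<^sup>2))) * (M - m) ^ 4 / n ^ 4
    = \<beta> * (j * (n - j) * (n\<^sup>2 - 3 * n * j + 3 * j\<^sup>2) / n ^ 3 * (M - m) ^ 4)"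
    using n by (simp add: eval_nat_numeral)
  finally have "F ?y = \<alpha> * (j * (n - j) / n * (M - m)\<^sup>2)
    + \<beta> * (j * (n - j) * (n\<^sup>2 - 3 * n * j + 3 * j\<^sup>2) / n ^ 3 * (M - m) ^ 4)" .
  moreover have "F x = \<alpha> * (\<Sum>i\<in>I. (x i)\<^sup>2) + \<beta> * (\<Sum>i\<in>I. (x i) ^ 4)"
    by (simp add: F_def mean_def assms(4) sum.distrib sum_distrib_left)
  ultimately show ?thesis
    using le card_mono[OF assms(1) S] unfolding j_def by auto
qed

section \<open>Newton's identities and factorisation over the real roots\<close>

lemma power_sums_from_coeffs:
  fixes r :: "'a \<Rightarrow> real"
  assumes "finite I"
  defines "c \<equiv> coeff (\<Prod>i\<in>I. [:1, - r i:])"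
  shows "c 0 = 1 \<and> (\<Sum>i\<in>I. r i) = - c 1 \<and> (\<Sum>i\<in>I. (r i)\<^sup>2) = (c 1)\<^sup>2 - 2 * c 2 \<and>
    (\<Sum>i\<in>I. r i ^ 4) = c 1 ^ 4 - 4 * (c 1)\<^sup>2 * c 2 + 2 * (c 2)\<^sup>2 + 4 * c 1 * c 3 - 4 * c 4"
  unfolding c_def using assms(1)
proof (induction I)
  case empty
  show ?case by (simp add: coeff_1)
next
  case (insert i I)
  define q where "q = (\<Prod>i\<in>I. [:1, - r i:])"
  have prod: "(\<Prod>i\<in>insert i I. [:1, - r i:]) = [:1, - r i:] * q"
    using insert.hyps by (simp add: q_def)
  \<comment> \<open>In the reversed product the k-th coefficient is (-1)^k times the k-th elementary
    symmetric function, whatever the number of roots. A new root thus acts by one uniform recursion,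
    and each Newton identity becomes a polynomial identity in the old coefficients.\<close>
  have coeffs: "coeff ([:1, - r i:] * q) 0 = coeff q 0"
    "coeff ([:1, - r i:] * q) 1 = coeff q 1 - r i * coeff q 0"
    "coeff ([:1, - r i:] * q) 2 = coeff q 2 - r i * coeff q 1"
    "coeff ([:1, - r i:] * q) 3 = coeff q 3 - r i * coeff q 2"
    "coeff ([:1, - r i:] * q) 4 = coeff q 4 - r i * coeff q 3"
    by (simp_all add: numeral_eq_Suc)
  note IH = insert.IH[folded q_def]
  have c0: "coeff q 0 = 1" using IH by blast
  have sums: "(\<Sum>k\<in>insert i I. r k ^ d) = r i ^ d + (\<Sum>k\<in>I. r k ^ d)" for d
    using insert.hyps by simp
  show ?case
    unfolding prod coeffs c0
  proof (intro conjI)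
    show "(\<Sum>k\<in>insert i I. r k) = - (coeff q 1 - r i * 1)"
      using insert.hyps IH by simp
    show "(\<Sum>k\<in>insert i I. (r k)\<^sup>2) =
      (coeff q 1 - r i * 1)\<^sup>2 - 2 * (coeff q 2 - r i * coeff q 1)"
      unfolding sums using IH by (simp add: power2_eq_square algebra_simps)
    have "(\<Sum>k\<in>I. r k ^ 4) = coeff q 1 ^ 4 - 4 * (coeff q 1)\<^sup>2 * coeff q 2
      + 2 * (coeff q 2)\<^sup>2 + 4 * coeff q 1 * coeff q 3 - 4 * coeff q 4" using IH by blast
    then show "(\<Sum>k\<in>insert i I. r k ^ 4) =
      (coeff q 1 - r i * 1) ^ 4 - 4 * (coeff q 1 - r i * 1)\<^sup>2 * (coeff q 2 - r i * coeff q 1) +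
      2 * (coeff q 2 - r i * coeff q 1)\<^sup>2 +
      4 * (coeff q 1 - r i * 1) * (coeff q 3 - r i * coeff q 2) -
      4 * (coeff q 4 - r i * coeff q 3)"
      unfolding sums by algebra
  qed simp
qed

text \<open>Splitting off the full power of one root lowers the degree and the number of roots
  equally, so the hypothesis is inherited. When no root is left, it forces degree 0.\<close>

lemma poly_eq_prod_proots:
  fixes p :: "'a :: idom poly"
  assumes "size (proots p) = degree p"
  shows "smult (lead_coeff p) (\<Prod>x\<in>#proots p. [:- x, 1:]) = p"
  using assms
proof (induction p rule: poly_root_order_induct)
  case (no_roots p)
  then have "proots p = {#}"
    by (simp add: multiset_eqI order_root)
  with no_roots.prems show ?case
    by (auto elim!: degree_eq_zeroE)
next
  case (root p x n)
  have [simp]: "p \<noteq> 0" using root.hyps by auto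
  have proots: "proots ([:- x, 1:] ^ n * p) = repeat_mset n {#x#} + proots p"
    by (simp add: proots_mult proots_power)
  have "size (proots p) = degree p"
    using root.prems by (simp add: proots degree_mult_eq degree_power_eq)
  from root.IH[OF this]
  have "smult (lead_coeff p) (\<Prod>x\<in>#proots p. [:- x, 1:]) = p" .
  moreover have "(\<Prod>x\<in>#repeat_mset n {#x#}. [:- x, 1:]) = [:- x, 1:] ^ n"
    by (induction n) simp_all
  ultimately show ?case
    unfolding proots by (simp add: lead_coeff_mult lead_coeff_power flip: mult_smult_right)
qed simp

text \<open>The sum of the orders is the size of \<open>proots f\<close>. Listing this multiset
  indexes the roots with multiplicity.\<close>

lemma all_roots_real_obtain_roots:
  assumes "all_roots_real f" "lead_coeff f = 1"
  obtains r where "f = (\<Prod>i<degree f. [:- r i, 1:])"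
proof -
  have [simp]: "f \<noteq> 0" using assms(2) by auto
  have "size (proots f) = degree f"
    using assms(1) by (simp add: all_roots_real_def size_multiset_overloaded_eq)
  moreover obtain rs where rs: "mset rs = proots f"
    using ex_mset by blast
  ultimately have "length rs = degree f" and "f = (\<Prod>x\<in>#mset rs. [:- x, 1:])"
    using poly_eq_prod_proots[of f] assms(2) by (metis size_mset, simp)
  moreover have "(\<Prod>x\<in>#mset rs. [:- x, 1:]) = (\<Prod>i<length rs. [:- rs ! i, 1:])"
    by (simp only: prod_mset_prod_list prod.list_conv_set_nth flip: mset_map)
      (simp add: atLeast0LessThan)
  ultimately show ?thesis using that[of "\<lambda>i. rs ! i"] by simp
qed

text \<open>In the binomial expansion the mixed terms of odd exponent carry the factor
  \<open>(\<Sum>i\<in>I. x i)\<close>, which is 0.\<close>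

lemma sum_pairs_power4_eq:
  fixes x :: "'a \<Rightarrow> real"
  assumes "finite I" "(\<Sum>i\<in>I. x i) = 0"
  shows "(\<Sum>i\<in>I. \<Sum>k\<in>I. (x i - x k) ^ 4) =
    2 * real (card I) * (\<Sum>i\<in>I. x i ^ 4) + 6 * (\<Sum>i\<in>I. (x i)\<^sup>2)\<^sup>2"
proof -
  have expand: "(x i - x k) ^ 4 =
      x i ^ 4 - 4 * (x i ^ 3 * x k) + 6 * ((x i)\<^sup>2 * (x k)\<^sup>2) - 4 * (x i * x k ^ 3) + x k ^ 4" for i k
    by algebra
  show ?thesis
    unfolding expand
    by (simp add: sum.distrib sum_subtractf assms(2) power2_eq_square[of "sum _ _"]
        flip: sum_distrib_left sum_distrib_right)
qed

theorem theorem4p2: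
  fixes n :: nat and a :: "nat \<Rightarrow> real" and f :: "real poly"
  assumes "n \<ge> 4"
    and "f = monom 1 n + (\<Sum>k=2..n. monom (a k) (n - k))"
    and "all_roots_real f"
  shows "spn f \<ge> root 4 (8 * (((a 2)\<^sup>2 - 2 * a 4) / real n + 6 * (a 2)\<^sup>2 / (real n)\<^sup>2))
    \<and> spn f \<ge> root 4 (2 * real n ^ 3 * ((a 2)\<^sup>2 - 2 * a 4) /
        (MAX j\<in>{1..n-1}. real j * (real n - real j) *
           ((real n)\<^sup>2 - 3 * real n * real j + 3 * (real j)\<^sup>2)))
    \<and> spn f \<ge> root 6 (3 ^ 5 / (real n)\<^sup>2 * a 2 * (2 * a 4 - (a 2)\<^sup>2))
    \<and> (odd n \<longrightarrow>
        spn f \<ge> root 4 (8 * real n / ((real n)\<^sup>2 - 1) *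
          ((a 2)\<^sup>2 - 2 * a 4 + 6 / real n * (a 2)\<^sup>2)))"
proof -

  \<comment> \<open>From the coefficients of \<open>f\<close> to the power sums of its roots\<close>
  have coeff_f: "coeff f m = (if m = n then 1 else if m + 2 \<le> n then a (n - m) else 0)" for m
  proof -
    \<comment> \<open>Only k = n - m can contribute; m = n - 1 would need k = 1, outside the
      range.\<close>
    have "(\<Sum>k=2..n. coeff (monom (a k) (n - k)) m) =
        (\<Sum>k=2..n. if k = n - m then (if m \<le> n then a k else 0) else 0)"
      by (intro sum.cong) auto
    then show ?thesis
      by (auto simp: assms(2) coeff_sum)
  qed
  have deg: "degree f = n"
    by (rule order.antisym) (auto intro!: degree_le le_degree simp: coeff_f)
  obtain r where r: "f = (\<Prod>i<n. [:- r i, 1:])"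
    using all_roots_real_obtain_roots[OF assms(3)] deg coeff_f by metis
  \<comment> \<open>For x = 0 the reversal drops in degree, and the right side collapses to the same
    constant 1.\<close>
  have "reflect_poly [:- x, 1:] = [:1, - x:]" for x :: real
    by (cases "x = 0") (simp_all add: reflect_poly_pCons reflect_poly_pCons')
  then have "reflect_poly f = (\<Prod>i<n. [:1, - r i:])"
    by (simp add: r reflect_poly_prod)
  moreover have "coeff (reflect_poly f) k = coeff f (n - k)" if "k \<le> n" for k
    using that by (simp add: coeff_reflect_poly deg)
  ultimately have coeff_prod: "coeff (\<Prod>i<n. [:1, - r i:]) k = coeff f (n - k)" if "k \<le> n" for k
    using that by simp
  have coeffs: "coeff (\<Prod>i<n. [:1, - r i:]) 1 = 0" "coeff (\<Prod>i<n. [:1, - r i:]) 2 = a 2"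
     "coeff (\<Prod>i<n. [:1, - r i:]) 4 = a 4"
    using assms(1) by (simp_all add: coeff_prod coeff_f)
  define P Q where "P = (\<Sum>i<n. (r i)\<^sup>2)" and "Q = (\<Sum>i<n. r i ^ 4)"
  have sum0: "(\<Sum>i<n. r i) = 0" and P: "P = - 2 * a 2" and Q: "Q = 2 * (a 2)\<^sup>2 - 4 * a 4"
    using power_sums_from_coeffs[of "{..<n}" r] unfolding coeffs P_def Q_def by simp_all
  define m M where "m = Min {x. poly f x = 0}" and "M = Max {x. poly f x = 0}"
  have fin: "finite {x. poly f x = 0}"
    using deg assms(1) by (intro poly_roots_finite) auto
  have "poly f (r i) = 0" if "i < n" for i
    using that by (auto simp: r poly_prod)
  then have box: "r ` {..<n} \<subseteq> {m..M}"
    using fin by (auto simp: m_def M_def)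
  define s where "s = spn f"
  have s: "s = M - m"
    by (simp add: s_def spn_def m_def M_def)
  have s0: "s \<ge> 0"
  proof -
    have "r 0 \<in> {m..M}" by (rule subsetD[OF box]) (use assms(1) in simp)
    then show ?thesis by (simp add: s)
  qed
  define N where "N = real n"
  have N: "N \<ge> 4" using assms(1) by (simp add: N_def)
  \<comment> \<open>\<open>root\<close> is odd and monotone on all reals, so a negative radicand
    needs no separate treatment.\<close>
  have root_le: "root k y \<le> s" if "y \<le> s ^ k" "k > 0" for y k
    using real_root_le_mono[OF that(2,1)] s0 that(2) by (simp add: real_root_power_cancel)

  \<comment> \<open>Pairwise differences: the first bound and the one for odd degree\<close>
  obtain j where "2 * N * Q + 6 * P\<^sup>2 \<le> 2 * real j * (N - real j) * s ^ 4"
    using sum_pairs_power4_le[OF _ box] sum_pairs_power4_eq[OF _ sum0]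
    by (auto simp: N_def P_def Q_def s)
  then have pairs: "2 * (2 * N * Q + 6 * P\<^sup>2) \<le> B * s ^ 4" if "4 * real j * (N - real j) \<le> B" for B
    using mult_right_mono[OF that, of "s ^ 4"] by simp
  have lhs: "8 * N * ((a 2)\<^sup>2 - 2 * a 4 + 6 / N * (a 2)\<^sup>2) = 2 * (2 * N * Q + 6 * P\<^sup>2)"
    unfolding P Q using N by (simp add: field_simps power2_eq_square)
  \<comment> \<open>This gives \<open>B\<close> = N^2 in general. For odd \<open>n\<close> the
    integer n - 2j is nonzero, so its square is at least 1 and \<open>B\<close> = N^2 - 1
    works.\<close>
  have sq: "4 * real j * (N - real j) = N\<^sup>2 - (N - 2 * real j)\<^sup>2"
    by algebra
  have 1: "8 * (((a 2)\<^sup>2 - 2 * a 4) / N + 6 * (a 2)\<^sup>2 / N\<^sup>2) \<le> s ^ 4"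
  proof -
    have "8 * (((a 2)\<^sup>2 - 2 * a 4) / N + 6 * (a 2)\<^sup>2 / N\<^sup>2) =
        8 * N * ((a 2)\<^sup>2 - 2 * a 4 + 6 / N * (a 2)\<^sup>2) / N\<^sup>2"
      using N by (simp add: field_simps power2_eq_square)
    also have "\<dots> \<le> N\<^sup>2 * s ^ 4 / N\<^sup>2"
      unfolding lhs by (intro divide_right_mono pairs) (simp_all add: sq)
    finally show ?thesis using N by simp
  qed
  have 4: "8 * N / (N\<^sup>2 - 1) * ((a 2)\<^sup>2 - 2 * a 4 + 6 / N * (a 2)\<^sup>2) \<le> s ^ 4" if "odd n"
  proof -
    have "int n - 2 * int j \<noteq> 0" using that by presburger
    then have "1 \<le> (int n - 2 * int j)\<^sup>2"
      by (metis zero_less_power2 int_one_le_iff_zero_less)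
    then have "real_of_int 1 \<le> real_of_int ((int n - 2 * int j)\<^sup>2)"
      by (simp only: of_int_le_iff)
    then have "(N - 2 * real j)\<^sup>2 \<ge> 1" by (simp add: N_def)
    then have "8 * N * ((a 2)\<^sup>2 - 2 * a 4 + 6 / N * (a 2)\<^sup>2) \<le> (N\<^sup>2 - 1) * s ^ 4"
      unfolding lhs by (intro pairs) (simp add: sq)
    moreover have "N\<^sup>2 - 1 > 0" using N by (simp add: power2_eq_square less_1_mult)
    ultimately show ?thesis by (simp add: field_simps)
  qed

  \<comment> \<open>Fourth central moment: the second bound\<close>
  define h where "h = (\<lambda>j. real j * (N - real j) * (N\<^sup>2 - 3 * N * real j + 3 * (real j)\<^sup>2))"
  have nonempty: "{..<n} \<noteq> {}"
    using assms(1) by (simp add: lessThan_empty_iff)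
  have moments: "\<exists>j\<le>n. \<alpha> * P + \<beta> * Q \<le>
      \<alpha> * (real j * (N - real j) / N * s\<^sup>2) + \<beta> * (h j / N ^ 3 * s ^ 4)"
    if "\<alpha> \<ge> 0" "\<beta> \<ge> 0" for \<alpha> \<beta>
    using central_moments_le[OF _ _ box sum0 that] nonempty
    by (simp add: N_def P_def Q_def s h_def)
  have 2: "2 * N ^ 3 * ((a 2)\<^sup>2 - 2 * a 4) / Max (h ` {1..n-1}) \<le> s ^ 4"
  proof -
    obtain j where j: "j \<le> n" "Q \<le> h j / N ^ 3 * s ^ 4"
      using moments[of 0 1] by auto
    have le: "h k \<le> Max (h ` {1..n-1})" if "k \<in> {1..n-1}" for k
      using that by auto
    \<comment> \<open>A positive maximum makes the division legitimate and also covers the vertices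
      j = 0 and j = n, which lie outside the index range but have \<open>h j\<close> = 0.\<close>
    have "0 < (N - 1) * ((N - 1) * (N - 2) + 1)"
      using N by (intro mult_pos_pos add_pos_pos) auto
    also have "\<dots> = h 1" by (simp add: h_def power2_eq_square algebra_simps)
    also have "\<dots> \<le> Max (h ` {1..n-1})" using assms(1) by (intro le) auto
    finally have pos: "0 < Max (h ` {1..n-1})" .
    have "h j \<le> Max (h ` {1..n-1})"
    proof (cases "j = 0 \<or> j = n")
      case True
      then show ?thesis using pos by (auto simp: h_def N_def)
    next
      case False
      then show ?thesis using j(1) by (intro le) auto
    qed
    then have "h j * s ^ 4 \<le> Max (h ` {1..n-1}) * s ^ 4"
      by (rule mult_right_mono) simp
    moreover have "N ^ 3 * Q \<le> h j * s ^ 4"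
      using j(2) N by (simp add: field_simps)
    ultimately have "N ^ 3 * Q \<le> Max (h ` {1..n-1}) * s ^ 4"
      by linarith
    then show ?thesis
      unfolding Q using pos by (simp add: field_simps)
  qed

  \<comment> \<open>Weighted second and fourth moments: the third bound\<close>
  have 3: "3 ^ 5 / N\<^sup>2 * a 2 * (2 * a 4 - (a 2)\<^sup>2) \<le> s ^ 6"
  proof (cases "s = 0")
    case True
    \<comment> \<open>The factor \<open>s\<^sup>2\<close> cannot be cancelled here, but zero span
      forces \<open>P\<close> = 0 and hence \<open>a 2\<close> = 0.\<close>
    have "P = 0" using moments[of 1 0] True
      by (auto simp: P_def intro!: antisym sum_nonneg)
    then show ?thesis using True by (simp add: P)
  next
    case False
    define A where "A = s\<^sup>2 / 3 * P + Q"
    obtain j where j: "A \<le> s\<^sup>2 / 3 * (real j * (N - real j) / N * s\<^sup>2) + h j / N ^ 3 * s ^ 4"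
      using moments[of "s\<^sup>2 / 3" 1] by (auto simp: A_def)
    define u where "u = real j * (N - real j) / N\<^sup>2"
    have uN: "real j * (N - real j) = u * N\<^sup>2"
      using N by (simp add: u_def)
    have "h j = real j * (N - real j) * (N\<^sup>2 - 3 * (real j * (N - real j)))"
      unfolding h_def by algebra
    then have "h j = u * N\<^sup>2 * (N\<^sup>2 - 3 * (u * N\<^sup>2))"
      by (simp only: uN)
    then have "h j / N ^ 3 = N * (u * (1 - 3 * u))"
      using N by (simp add: field_simps eval_nat_numeral)
    then have "A \<le> s\<^sup>2 / 3 * (u * N * s\<^sup>2) + N * (u * (1 - 3 * u)) * s ^ 4"
      using j N uN by (simp add: power2_eq_square)
    \<comment> \<open>Completing the square in u/3 + u(1 - 3u) = 4u/3 - 3u^2.\<close>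
    also have "\<dots> = N * s ^ 4 * (4 / 27 - 3 * (u - 2 / 9)\<^sup>2)"
      by (simp add: field_simps eval_nat_numeral)
    also have "\<dots> \<le> N * s ^ 4 * (4 / 27)"
      using N by (intro mult_left_mono) auto
    finally have A: "A \<le> 4 / 27 * N * s ^ 4" by simp
    \<comment> \<open>These signs make \<open>A\<close> nonnegative, so its upper bound may be
      squared.\<close>
    have PQ0: "P \<ge> 0" "Q \<ge> 0" by (auto simp: P_def Q_def intro!: sum_nonneg)
    have "4 * (s\<^sup>2 / 3 * P * Q) = A\<^sup>2 - (s\<^sup>2 / 3 * P - Q)\<^sup>2"
      by (simp add: A_def power2_eq_square field_simps)
    also have "\<dots> \<le> A\<^sup>2" by simp
    also have "\<dots> \<le> (4 / 27 * N * s ^ 4)\<^sup>2"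
      using A PQ0 by (intro power_mono) (auto simp: A_def)
    finally have "s\<^sup>2 * (P * Q) \<le> s\<^sup>2 * (4 / 243 * N\<^sup>2 * s ^ 6)"
      by (simp add: power_mult_distrib power_divide eval_nat_numeral mult_ac)
    then have "P * Q \<le> 4 / 243 * N\<^sup>2 * s ^ 6"
      using False by simp
    \<comment> \<open>Here PQ = 4 a_2 (2 a_4 - a_2^2), and 243 = 3^5.\<close>
    then show ?thesis
      unfolding P Q using N by (simp add: field_simps)
  qed

  show ?thesis
    using root_le[OF 1] root_le[OF 2] root_le[OF 3] root_le[OF 4]
    by (simp add: N_def s_def h_def)
qed

end
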